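(* Let $(G,+)$ be a finite abelian group and let ${\bf F}$ be a field of characteristic zero or of characteristic $p$ not dividing $|G|$. Let ${\bf E}$ be an extension of ${\bf F}$ containing a primitive $N$-th root of unity, where $N={\rm exp}(G)$, and let $\hat G$ be the group of ${\bf E}$-valued characters of $G$. Then for any subgroup ${\cal K}$ of $\hat G$ and any function $f:G\to{\bf F}$ whose Fourier transform $\hat f$ is not identically zero on ${\cal K}$, \[ |{\rm supp}(f)|\,|{\rm supp}(\hat f)\cap{\cal K}|\ \ge\ |{\cal K}|, \] and equality holds only if ${\rm supp}(\hat f)\cap{\cal K}$ is a coset of a subgroup of ${\cal K}$. In particular, if $f:G\to{\bf F}$ is nonzero, then $|{\rm supp}(f)|\,|{\rm supp}(\hat f)|\ge|G|$, with equality if and only if $f=\lambda\,\chi\, I_{a+H}$ for some $\lambda\in{\bf E}\setminus\{0\}$, some $\chi\in\hat G$, some $a\in G$ and some subgroup $H$ of $G$, where $I_{a+H}$ is the indicator function of the coset $a+H$.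
   Context: Characters are group homomorphisms $G\to{\bf E}^*$; $\hat G$ is the group of characters under pointwise multiplication, written additively. The Fourier transform is $\hat f(\chi)=\sum_{x\in G}f(x)\chi(-x)$. ${\rm supp}(f)=\{x\in G:f(x)\ne0\}$, ${\rm supp}(\hat f)=\{\chi\in\hat G:\hat f(\chi)\ne0\}$. The product $\lambda\chi I_{a+H}$ is the pointwise product of functions on $G$. *)

theory Defs
  imports
    "HOL-Algebra.Algebraic_Closure_Type"
    "HOL-Algebra.Coset"
    "HOL-Library.Indicator_Function"
begin

text \<open>
  A finite abelian group is a \<^locale>\<open>comm_group\<close> with finite carrier, so the group written
  additively on paper is in HOL-Algebra's multiplicative notation here. Fields are types of class
  \<^class>\<open>field\<close>, with \<^const>\<open>ring_of_type_algebra\<close> as the bridge to HOL-Algebra. Functions on the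
  group are total HOL functions whose values outside the carrier are irrelevant.
\<close>

definition group_exponent :: "('g, 'm) monoid_scheme \<Rightarrow> nat" where
  "group_exponent G = (LEAST n. 0 < n \<and> (\<forall>x\<in>carrier G. x [^]\<^bsub>G\<^esub> n = \<one>\<^bsub>G\<^esub>))"

definition primitive_root_of_unity :: "nat \<Rightarrow> 'e::field \<Rightarrow> bool" where
  "primitive_root_of_unity n z \<longleftrightarrow> 0 < n \<and> z ^ n = 1 \<and> (\<forall>k. 0 < k \<and> k < n \<longrightarrow> z ^ k \<noteq> 1)"

text \<open>
  Characters are made extensional (equal to \<^const>\<open>undefined\<close> off the carrier), so that two
  characters agreeing on the carrier are equal and cardinalities of sets of characters are right.
\<close>

definition char_group :: "('g, 'm) monoid_scheme \<Rightarrow> ('g \<Rightarrow> 'e::field) monoid" where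
  "char_group G =
    \<lparr> carrier = hom G (units_of (ring_of_type_algebra :: 'e ring)) \<inter> extensional (carrier G),
      monoid.mult = (\<lambda>\<chi> \<psi>. \<lambda>x\<in>carrier G. \<chi> x * \<psi> x),
      one = (\<lambda>x\<in>carrier G. 1) \<rparr>"

definition fourier :: "('g, 'm) monoid_scheme \<Rightarrow> ('g \<Rightarrow> 'e::field) \<Rightarrow> ('g \<Rightarrow> 'e) \<Rightarrow> 'e" where
  "fourier G f \<chi> = (\<Sum>x\<in>carrier G. f x * \<chi> (inv\<^bsub>G\<^esub> x))"

definition supp_on :: "('x, 'm) monoid_scheme \<Rightarrow> ('x \<Rightarrow> 'b::zero) \<Rightarrow> 'x set" where
  "supp_on M f = {x \<in> carrier M. f x \<noteq> 0}"

lemma units_of_ring_of_type_algebra: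
  "units_of (ring_of_type_algebra :: 'e::field ring) = \<lparr>carrier = - {0}, monoid.mult = (*), one = 1\<rparr>"
proof -
  have "\<exists>y. y * x = 1 \<and> x * y = 1" if "x \<noteq> 0" for x :: 'e
    by (rule exI[of _ "inverse x"]) (use that in simp)
  then show ?thesis
    by (auto simp: units_of_def Units_def ring_of_type_algebra_def)
qed

lemma mem_char_group_iff:
  "\<chi> \<in> carrier (char_group G :: ('g \<Rightarrow> 'e::field) monoid) \<longleftrightarrow>
     \<chi> \<in> extensional (carrier G) \<and> (\<forall>x\<in>carrier G. \<chi> x \<noteq> 0) \<and>
     (\<forall>x\<in>carrier G. \<forall>y\<in>carrier G. \<chi> (x \<otimes>\<^bsub>G\<^esub> y) = \<chi> x * \<chi> y)"
  by (auto simp: char_group_def hom_def units_of_ring_of_type_algebra)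

lemma comm_group_char_group:
  assumes "group G"
  shows "comm_group (char_group G :: ('g \<Rightarrow> 'e::field) monoid)"
proof -
  interpret group G by fact
  show ?thesis
  proof (rule comm_groupI)
    fix \<chi> :: "'g \<Rightarrow> 'e"
    assume \<chi>: "\<chi> \<in> carrier (char_group G)"
    let ?\<psi> = "\<lambda>x\<in>carrier G. inverse (\<chi> x)"
    have "?\<psi> \<in> carrier (char_group G)"
      using \<chi> by (auto simp: mem_char_group_iff)
    moreover have "?\<psi> \<otimes>\<^bsub>char_group G\<^esub> \<chi> = \<one>\<^bsub>char_group G\<^esub>"
      using \<chi> by (auto simp: mem_char_group_iff) (auto simp: char_group_def fun_eq_iff)
    ultimately show "\<exists>\<psi>\<in>carrier (char_group G). \<psi> \<otimes>\<^bsub>char_group G\<^esub> \<chi> = \<one>\<^bsub>char_group G\<^esub>"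
      by blast
  next
    fix \<chi> :: "'g \<Rightarrow> 'e"
    assume "\<chi> \<in> carrier (char_group G)"
    then show "\<one>\<^bsub>char_group G\<^esub> \<otimes>\<^bsub>char_group G\<^esub> \<chi> = \<chi>"
      by (auto simp: mem_char_group_iff) (auto simp: char_group_def fun_eq_iff extensional_def)
  qed (unfold mem_char_group_iff, auto simp: char_group_def fun_eq_iff mult_ac)
qed

end

theory Submission
  imports Defs "HOL.Vector_Spaces" "HOL-Library.Function_Algebras"
begin

text \<open>
  Let \<open>F\<close> be a nonzero function on a finite group \<open>M\<close>, and let \<open>d\<close> be the dimension of the span of its
  translates. The supports of a basis of translates cover \<open>M\<close>, whence \<open>|M| \<le> d |supp F|\<close>. If
  equality holds, then the supports of two independent translates, being part of a basis, are
  disjoint. Overlapping translates are therefore proportional, and \<open>supp F\<close> is a coset of the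
  subgroup of those \<open>h\<close> for which translation by \<open>h\<close> multiplies \<open>F\<close> by a constant.

  If \<open>F\<close> is the Fourier transform of \<open>f\<close> on a subgroup \<open>K\<close> of the dual group, then
  \<open>d \<le> |supp f|\<close>, since \<open>F\<close> is a combination of \<open>|supp f|\<close> multiplicative functions. If \<open>F\<close> is \<open>f\<close>
  itself, then \<open>d\<close> equals the size of the support of its transform: the characters in that support
  form a basis of the span of the translates of \<open>f\<close>. This rests on the fact that the characters
  span all functions: translations are commuting operators annihilated by \<open>X^N - 1\<close>, which has
  \<open>N\<close> distinct roots in the field, so they are simultaneously diagonalizable, and their common
  eigenfunctions are multiples of characters.
\<close>

section \<open>Function spaces\<close>

definition scale_fun :: "'e::times \<Rightarrow> ('a \<Rightarrow> 'e) \<Rightarrow> 'a \<Rightarrow> 'e"  (infixr \<open>*\<^sub>F\<close> 75) where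
  "c *\<^sub>F f = (\<lambda>x. c * f x)"

lemma scale_fun_apply [simp]: "(c *\<^sub>F f) x = c * f x"
  by (simp add: scale_fun_def)

interpretation fun_space: vector_space "scale_fun :: 'e::field \<Rightarrow> ('a \<Rightarrow> 'e) \<Rightarrow> 'a \<Rightarrow> 'e"
  by unfold_locales (auto simp: fun_eq_iff algebra_simps)

lemma sum_fun_apply [simp]:
  fixes f :: "'i \<Rightarrow> 'a \<Rightarrow> 'b::comm_monoid_add"
  shows "(\<Sum>i\<in>I. f i) x = (\<Sum>i\<in>I. f i x)"
  by (induction I rule: infinite_finite_induct) auto

lemma (in vector_space) card_independent_le_dim:
  assumes "finite W" "independent B" "B \<subseteq> span W"
  shows "card B \<le> dim W"
proof -
  obtain C where C: "C \<subseteq> W" "W \<subseteq> span C" "card C = dim W"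
    using basis_exists .
  have "B \<subseteq> span C"
    using assms(3) span_minimal[OF C(2) subspace_span] by blast
  then show ?thesis
    using independent_span_bound[of C B] assms C finite_subset by metis
qed

definition supp :: "('a \<Rightarrow> 'b::zero) \<Rightarrow> 'a set" where
  "supp f = {x. f x \<noteq> 0}"

lemma mem_supp_iff [simp]: "x \<in> supp f \<longleftrightarrow> f x \<noteq> 0"
  by (simp add: supp_def)

definition extend_by_zero :: "'a set \<Rightarrow> ('a \<Rightarrow> 'b::zero) \<Rightarrow> 'a \<Rightarrow> 'b" where
  "extend_by_zero A f = (\<lambda>x. if x \<in> A then f x else 0)"

lemma extend_by_zero_apply [simp]: "extend_by_zero A f x = (if x \<in> A then f x else 0)"
  by (simp add: extend_by_zero_def)

lemma supp_extend_by_zero: "supp (extend_by_zero A f) \<subseteq> A"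
  by (auto split: if_splits)

lemma supp_subset_of_span:
  fixes f :: "'a \<Rightarrow> 'e::field"
  assumes "f \<in> fun_space.span B"
  shows "supp f \<subseteq> (\<Union>b\<in>B. supp b)"
proof -
  let ?V = "{g :: 'a \<Rightarrow> 'e. supp g \<subseteq> (\<Union>b\<in>B. supp b)}"
  have "fun_space.subspace ?V"
  proof (rule fun_space.subspaceI)
    show "g + h \<in> ?V" if "g \<in> ?V" "h \<in> ?V" for g h
    proof -
      have "supp (g + h) \<subseteq> supp g \<union> supp h"
        by auto
      then show ?thesis
        using that by blast
    qed
    show "c *\<^sub>F g \<in> ?V" if "g \<in> ?V" for c g
      using that by auto
  qed auto
  then have "fun_space.span B \<subseteq> ?V"
    by (intro fun_space.span_minimal) auto
  then show ?thesis
    using assms by auto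
qed

lemma in_span_indicators:
  fixes f :: "'a \<Rightarrow> 'e::field"
  assumes "finite A" "supp f \<subseteq> A"
  shows "f \<in> fun_space.span ((\<lambda>x. indicator {x}) ` A)"
proof -
  have "f = (\<Sum>x\<in>A. f x *\<^sub>F indicator {x})"
  proof
    fix y
    have "(\<Sum>x\<in>A. f x *\<^sub>F indicator {x}) y = (\<Sum>x\<in>A. if y = x then f x else 0)"
      by (auto intro!: sum.cong)
    also have "\<dots> = f y"
      using assms by auto
    finally show "f y = (\<Sum>x\<in>A. f x *\<^sub>F indicator {x}) y" ..
  qed
  also have "\<dots> \<in> fun_space.span ((\<lambda>x. indicator {x}) ` A)"
    by (intro fun_space.span_sum fun_space.span_scale fun_space.span_base) auto
  finally show ?thesis .
qed

section \<open>Families of functions with supports of equal size\<close>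

lemma card_Union_supp_le_of_independent:
  fixes W :: "('a \<Rightarrow> 'e::field) set"
  assumes W: "finite W" "\<And>w. w \<in> W \<Longrightarrow> card (supp w) = k"
    and A: "A \<subseteq> W" "fun_space.independent A"
  shows "card (\<Union>w\<in>W. supp w) + card A * k \<le> card (\<Union>w\<in>A. supp w) + fun_space.dim W * k"
proof -
  obtain B where B: "A \<subseteq> B" "B \<subseteq> W" "fun_space.independent B" "W \<subseteq> fun_space.span B"
    using fun_space.maximal_independent_subset_extend[OF A] .
  have finite_B: "finite B" and finite_A: "finite A"
    using W(1) A(1) B(2) finite_subset by auto
  have "(\<Union>w\<in>W. supp w) \<subseteq> (\<Union>w\<in>B. supp w)"
    using B(4) by (intro UN_least supp_subset_of_span) auto
  also have "\<dots> = (\<Union>w\<in>A. supp w) \<union> (\<Union>w\<in>B - A. supp w)"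
    using B(1) by blast
  finally have "(\<Union>w\<in>W. supp w) = (\<Union>w\<in>A. supp w) \<union> (\<Union>w\<in>B - A. supp w)"
    using A(1) B(2) by blast
  then have "card (\<Union>w\<in>W. supp w) \<le> card (\<Union>w\<in>A. supp w) + card (\<Union>w\<in>B - A. supp w)"
    by (metis card_Un_le)
  also have "card (\<Union>w\<in>B - A. supp w) \<le> (\<Sum>w\<in>B - A. card (supp w))"
    using finite_B by (intro card_UN_le) auto
  also have "\<dots> = card (B - A) * k"
    using W(2) B(2) by (simp add: subset_iff)
  finally have "card (\<Union>w\<in>W. supp w) + card A * k
      \<le> card (\<Union>w\<in>A. supp w) + (card (B - A) + card A) * k"
    by (simp add: add_mult_distrib)
  also have "card (B - A) + card A = card B"
    using card_Diff_subset[OF finite_A B(1)] card_mono[OF finite_B B(1)] by simp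
  also have "card B = fun_space.dim W"
    using B by (intro fun_space.basis_card_eq_dim)
  finally show ?thesis .
qed

corollary card_Union_supp_le_dim:
  fixes W :: "('a \<Rightarrow> 'e::field) set"
  assumes "finite W" "\<And>w. w \<in> W \<Longrightarrow> card (supp w) = k"
  shows "card (\<Union>w\<in>W. supp w) \<le> fun_space.dim W * k"
  using card_Union_supp_le_of_independent[OF assms, of "{}"] by (simp add: fun_space.independent_empty)

lemma overlapping_supp_proportional:
  fixes W :: "('a \<Rightarrow> 'e::field) set"
  assumes W: "finite W" "\<And>w. w \<in> W \<Longrightarrow> card (supp w) = k"
    and finite_supp: "finite (\<Union>w\<in>W. supp w)"
    and card_eq: "card (\<Union>w\<in>W. supp w) = fun_space.dim W * k"
    and uv: "u \<in> W" "v \<in> W" and overlap: "supp u \<inter> supp v \<noteq> {}"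
  shows "\<exists>c. v = c *\<^sub>F u"
proof (rule ccontr)
  assume not_proportional: "\<nexists>c. v = c *\<^sub>F u"
  have "u \<noteq> 0"
    using overlap by auto
  moreover have "v \<notin> fun_space.span {u}"
    using not_proportional by (auto simp: fun_space.span_singleton)
  moreover from this have "v \<noteq> u"
    using fun_space.span_base by blast
  ultimately have "2 * k \<le> card (supp u \<union> supp v)"
    using card_Union_supp_le_of_independent[OF W, of "{v, u}"] card_eq uv
    by (simp add: fun_space.independent_insert fun_space.independent_empty Un_commute)
  moreover have finite_uv: "finite (supp u)" "finite (supp v)"
    using finite_supp uv finite_subset[OF UN_upper] by metis+
  moreover from this have "card (supp u) + card (supp v)
      = card (supp u \<union> supp v) + card (supp u \<inter> supp v)"
    by (rule card_Un_Int)
  ultimately have "card (supp u \<inter> supp v) = 0"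
    using W(2)[OF uv(1)] W(2)[OF uv(2)] by linarith
  then show False
    using finite_uv overlap by simp
qed

section \<open>Translates of a function on a group\<close>

context group
begin

definition translate :: "('a \<Rightarrow> 'e::zero) \<Rightarrow> 'a \<Rightarrow> 'a \<Rightarrow> 'e" where
  "translate F a = extend_by_zero (carrier G) (\<lambda>z. F (a \<otimes> z))"

definition translates :: "('a \<Rightarrow> 'e::zero) \<Rightarrow> ('a \<Rightarrow> 'e) set" where
  "translates F = translate F ` carrier G"

lemma translate_apply: "z \<in> carrier G \<Longrightarrow> translate F a z = F (a \<otimes> z)"
  by (simp add: translate_def)

lemma supp_translate_subset: "supp (translate F a) \<subseteq> carrier G"
  unfolding translate_def by (rule supp_extend_by_zero)

lemma finite_translates: "finite (carrier G) \<Longrightarrow> finite (translates F)"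
  by (simp add: translates_def)

lemma card_supp_translates:
  assumes "w \<in> translates F"
  shows "card (supp w) = card (supp_on G F)"
proof -
  obtain a where a: "a \<in> carrier G" "w = translate F a"
    using assms by (auto simp: translates_def)
  have "bij_betw (\<lambda>z. a \<otimes> z) (supp (translate F a)) (supp_on G F)"
    by (rule bij_betw_byWitness[where f' = "\<lambda>z. inv a \<otimes> z"])
       (use a(1) in \<open>auto simp: translate_def supp_on_def m_assoc[symmetric] split: if_splits\<close>)
  then show ?thesis
    unfolding a(2) by (rule bij_betw_same_card)
qed

lemma Union_supp_translates:
  assumes "supp_on G F \<noteq> {}"
  shows "(\<Union>w\<in>translates F. supp w) = carrier G"
proof
  show "(\<Union>w\<in>translates F. supp w) \<subseteq> carrier G"
    using supp_translate_subset by (auto simp: translates_def)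
  obtain t where t: "t \<in> carrier G" "F t \<noteq> 0"
    using assms by (auto simp: supp_on_def)
  show "carrier G \<subseteq> (\<Union>w\<in>translates F. supp w)"
  proof
    fix z assume z: "z \<in> carrier G"
    then have "z \<in> supp (translate F (t \<otimes> inv z))"
      using t by (simp add: translate_apply m_assoc)
    then show "z \<in> (\<Union>w\<in>translates F. supp w)"
      using t(1) z by (auto simp: translates_def)
  qed
qed

lemma card_carrier_le_dim_translates:
  fixes F :: "'a \<Rightarrow> 'e::field"
  assumes "finite (carrier G)" "supp_on G F \<noteq> {}"
  shows "card (carrier G) \<le> fun_space.dim (translates F) * card (supp_on G F)"
  using card_Union_supp_le_dim[OF finite_translates[OF assms(1)], of F "card (supp_on G F)"]
  by (simp add: card_supp_translates Union_supp_translates[OF assms(2)])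

definition multiplier_group :: "('a \<Rightarrow> 'e::field) \<Rightarrow> 'a set" where
  "multiplier_group F = {a \<in> carrier G. \<exists>\<mu>. \<mu> \<noteq> 0 \<and> (\<forall>z\<in>carrier G. F (a \<otimes> z) = \<mu> * F z)}"

lemma multiplier_groupI:
  "\<lbrakk>a \<in> carrier G; \<mu> \<noteq> 0; \<And>z. z \<in> carrier G \<Longrightarrow> F (a \<otimes> z) = \<mu> * F z\<rbrakk>
    \<Longrightarrow> a \<in> multiplier_group F"
  by (auto simp: multiplier_group_def)

lemma subgroup_multiplier_group: "subgroup (multiplier_group F) G"
proof (rule subgroupI)
  show "multiplier_group F \<subseteq> carrier G"
    by (auto simp: multiplier_group_def)
  have "\<one> \<in> multiplier_group F"
    by (rule multiplier_groupI[of _ 1]) auto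
  then show "multiplier_group F \<noteq> {}"
    by blast
next
  fix a assume "a \<in> multiplier_group F"
  then obtain \<mu> where a: "a \<in> carrier G" "\<mu> \<noteq> 0" "\<And>z. z \<in> carrier G \<Longrightarrow> F (a \<otimes> z) = \<mu> * F z"
    by (auto simp: multiplier_group_def)
  have "F (inv a \<otimes> z) = inverse \<mu> * F z" if "z \<in> carrier G" for z
    using a(3)[of "inv a \<otimes> z"] a(1,2) that by (simp add: m_assoc[symmetric] field_simps)
  then show "inv a \<in> multiplier_group F"
    using a by (intro multiplier_groupI[of _ "inverse \<mu>"]) auto
next
  fix a b assume a_mem: "a \<in> multiplier_group F" and b_mem: "b \<in> multiplier_group F"
  obtain \<mu> where a: "a \<in> carrier G" "\<mu> \<noteq> 0" "\<And>z. z \<in> carrier G \<Longrightarrow> F (a \<otimes> z) = \<mu> * F z"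
    using a_mem by (auto simp: multiplier_group_def)
  obtain \<nu> where b: "b \<in> carrier G" "\<nu> \<noteq> 0" "\<And>z. z \<in> carrier G \<Longrightarrow> F (b \<otimes> z) = \<nu> * F z"
    using b_mem by (auto simp: multiplier_group_def)
  show "a \<otimes> b \<in> multiplier_group F"
    by (rule multiplier_groupI[of _ "\<mu> * \<nu>"]) (use a b in \<open>auto simp: m_assoc\<close>)
qed

lemma overlapping_translate_imp_multiplier:
  fixes F :: "'a \<Rightarrow> 'e::field"
  assumes finite_carrier: "finite (carrier G)"
    and dim_mult_card_le: "fun_space.dim (translates F) * card (supp_on G F) \<le> card (carrier G)"
    and a: "a \<in> carrier G" and t: "t \<in> carrier G" "F t \<noteq> 0" "F (a \<otimes> t) \<noteq> 0"
  shows "a \<in> multiplier_group F"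
proof -
  have nonempty: "supp_on G F \<noteq> {}"
    using t by (auto simp: supp_on_def)
  note cover = Union_supp_translates[OF nonempty]
  have card_eq: "card (carrier G) = fun_space.dim (translates F) * card (supp_on G F)"
    using card_carrier_le_dim_translates[OF finite_carrier nonempty] dim_mult_card_le by simp
  have "\<exists>c. translate F a = c *\<^sub>F translate F \<one>"
  proof (rule overlapping_supp_proportional[OF finite_translates[OF finite_carrier],
        of F "card (supp_on G F)"])
    have "t \<in> supp (translate F \<one>) \<inter> supp (translate F a)"
      using t by (simp add: translate_apply)
    then show "supp (translate F \<one>) \<inter> supp (translate F a) \<noteq> {}"
      by blast
  qed (use finite_carrier card_eq a in \<open>simp_all only: cover card_supp_translates\<close>,
      simp_all add: translates_def)
  then obtain c where "translate F a = c *\<^sub>F translate F \<one>" ..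
  then have scaled: "F (a \<otimes> z) = c * F z" if "z \<in> carrier G" for z
    using that translate_apply[of z F a] by (simp add: translate_apply)
  moreover have "c \<noteq> 0"
    using scaled[of t] t by auto
  ultimately show ?thesis
    using a by (intro multiplier_groupI)
qed

lemma supp_on_eq_coset_multiplier_group:
  fixes F :: "'a \<Rightarrow> 'e::field"
  assumes finite_carrier: "finite (carrier G)"
    and dim_mult_card_le: "fun_space.dim (translates F) * card (supp_on G F) \<le> card (carrier G)"
    and t: "t \<in> supp_on G F"
  shows "supp_on G F = multiplier_group F #> t"
proof
  have t': "t \<in> carrier G" "F t \<noteq> 0"
    using t by (auto simp: supp_on_def)
  show "supp_on G F \<subseteq> multiplier_group F #> t"
  proof
    fix x assume "x \<in> supp_on G F"
    then have x: "x \<in> carrier G" "F x \<noteq> 0"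
      by (auto simp: supp_on_def)
    have "x \<otimes> inv t \<in> multiplier_group F"
      by (rule overlapping_translate_imp_multiplier[OF finite_carrier dim_mult_card_le _ t'])
         (use x t' in \<open>auto simp: m_assoc\<close>)
    moreover have "x = x \<otimes> inv t \<otimes> t"
      using x t' by (simp add: m_assoc)
    ultimately show "x \<in> multiplier_group F #> t"
      by (auto simp: r_coset_def)
  qed
  show "multiplier_group F #> t \<subseteq> supp_on G F"
    using t' by (auto simp: r_coset_def multiplier_group_def supp_on_def)
qed

lemma translate_multiplier_mult:
  assumes "h \<in> multiplier_group F" "b \<in> carrier G"
  shows "\<exists>\<mu>. translate F (h \<otimes> b) = \<mu> *\<^sub>F translate F b"
proof -
  obtain \<mu> where h: "h \<in> carrier G" and \<mu>: "\<And>z. z \<in> carrier G \<Longrightarrow> F (h \<otimes> z) = \<mu> * F z"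
    using assms(1) by (auto simp: multiplier_group_def)
  then have "translate F (h \<otimes> b) = \<mu> *\<^sub>F translate F b"
    using assms(2) by (auto simp: fun_eq_iff translate_def m_assoc)
  then show ?thesis ..
qed

lemma dim_translates_mult_card_le:
  fixes F :: "'a \<Rightarrow> 'e::field"
  assumes finite_carrier: "finite (carrier G)" and H: "subgroup H G" "H \<subseteq> multiplier_group F"
  shows "fun_space.dim (translates F) * card H \<le> card (carrier G)"
proof -
  define rep where "rep C = (SOME x. x \<in> C)" for C :: "'a set"
  let ?T = "(\<lambda>C. translate F (rep C)) ` (rcosets H)"
  have "translate F a \<in> fun_space.span ?T" if a: "a \<in> carrier G" for a
  proof -
    define b where "b = rep (H #> a)"
    have b: "b \<in> H #> a"
      unfolding b_def rep_def using rcos_self[OF a H(1)] by (rule someI)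
    then have b_carrier: "b \<in> carrier G"
      using r_coset_subset_G[OF subgroup.subset[OF H(1)] a] by blast
    have "a \<in> H #> b"
      using repr_independence[OF b a H(1)] rcos_self[OF a H(1)] by simp
    then obtain h where "h \<in> H" "a = h \<otimes> b"
      by (auto simp: r_coset_def)
    then obtain \<mu> where "translate F a = \<mu> *\<^sub>F translate F b"
      using translate_multiplier_mult[OF _ b_carrier] H(2) by blast
    moreover have "translate F b \<in> ?T"
      unfolding b_def using rcosetsI[OF subgroup.subset[OF H(1)] a] by (rule imageI)
    ultimately show ?thesis
      by (simp add: fun_space.span_scale fun_space.span_base)
  qed
  then have "translates F \<subseteq> fun_space.span ?T"
    by (auto simp: translates_def)
  moreover have finite_rcosets: "finite (rcosets H)"
    using finite_carrier by (simp add: RCOSETS_def)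
  ultimately have "fun_space.dim (translates F) \<le> card ?T"
    by (intro fun_space.dim_le_card finite_imageI)
  also have "\<dots> \<le> card (rcosets H)"
    using finite_rcosets by (rule card_image_le)
  finally show ?thesis
    using lagrange[OF H(1)] mult_le_mono1[of _ "card (rcosets H)" "card H"]
    by (simp add: Coset.order_def)
qed

lemma dim_translates_le_of_multiplicative_sum:
  fixes F :: "'a \<Rightarrow> 'e::field"
  assumes S: "finite S"
    and mult: "\<And>s x y. \<lbrakk>s \<in> S; x \<in> carrier G; y \<in> carrier G\<rbrakk> \<Longrightarrow> e s (x \<otimes> y) = e s x * e s y"
    and F: "\<And>x. x \<in> carrier G \<Longrightarrow> F x = (\<Sum>s\<in>S. c s * e s x)"
  shows "fun_space.dim (translates F) \<le> card S"
proof -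
  let ?e = "\<lambda>s. extend_by_zero (carrier G) (e s)"
  have "translate F a \<in> fun_space.span (?e ` S)" if a: "a \<in> carrier G" for a
  proof -
    have "translate F a = (\<Sum>s\<in>S. (c s * e s a) *\<^sub>F ?e s)"
      using a by (auto simp: fun_eq_iff translate_def F mult mult.assoc)
    also have "\<dots> \<in> fun_space.span (?e ` S)"
      by (intro fun_space.span_sum fun_space.span_scale fun_space.span_base) auto
    finally show ?thesis .
  qed
  then have "fun_space.dim (translates F) \<le> card (?e ` S)"
    using S by (intro fun_space.dim_le_card) (auto simp: translates_def)
  also have "\<dots> \<le> card S"
    using S by (rule card_image_le)
  finally show ?thesis .
qed

end

section \<open>Orthogonality of characters\<close>

lemma fourier_extend_by_zero [simp]: "fourier G (extend_by_zero (carrier G) f) \<chi> = fourier G f \<chi>"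
  by (simp add: fourier_def)

lemma fourier_zero [simp]: "fourier G 0 \<chi> = 0"
  by (simp add: fourier_def)

lemma fourier_add: "fourier G (f + g) \<chi> = fourier G f \<chi> + fourier G g \<chi>"
  by (simp add: fourier_def distrib_right sum.distrib)

lemma fourier_scale: "fourier G (c *\<^sub>F f) \<chi> = c * fourier G f \<chi>"
  by (simp add: fourier_def sum_distrib_left mult.assoc)

lemma fourier_eq_sum_supp_on:
  assumes "finite (carrier G)"
  shows "fourier G f \<chi> = (\<Sum>x\<in>supp_on G f. f x * \<chi> (inv\<^bsub>G\<^esub> x))"
  unfolding fourier_def using assms by (intro sum.mono_neutral_right) (auto simp: supp_on_def)

context group
begin

lemma char_mult:
    "\<lbrakk>\<chi> \<in> carrier (char_group G); x \<in> carrier G; y \<in> carrier G\<rbrakk> \<Longrightarrow> \<chi> (x \<otimes> y) = \<chi> x * \<chi> y"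
  and char_nonzero: "\<lbrakk>\<chi> \<in> carrier (char_group G); x \<in> carrier G\<rbrakk> \<Longrightarrow> \<chi> x \<noteq> 0"
  by (auto simp: mem_char_group_iff)

lemma char_one: "\<chi> \<in> carrier (char_group G) \<Longrightarrow> \<chi> \<one> = 1"
  using char_mult[of \<chi> \<one> \<one>] char_nonzero[of \<chi> \<one>] by simp

lemma char_inv: "\<lbrakk>\<chi> \<in> carrier (char_group G); x \<in> carrier G\<rbrakk> \<Longrightarrow> \<chi> (inv x) = inverse (\<chi> x)"
  using char_mult[of \<chi> x "inv x"] char_nonzero[of \<chi> x] char_one[of \<chi>]
  by (simp add: inverse_unique)

lemma char_eqI:
  "\<lbrakk>\<chi> \<in> carrier (char_group G); \<psi> \<in> carrier (char_group G); \<And>x. x \<in> carrier G \<Longrightarrow> \<chi> x = \<psi> x\<rbrakk>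
    \<Longrightarrow> \<chi> = \<psi>"
  by (auto simp: mem_char_group_iff intro: extensionalityI)

lemma inj_on_extend_char: "inj_on (extend_by_zero (carrier G)) (carrier (char_group G))"
  by (rule inj_onI, rule char_eqI) (auto simp: fun_eq_iff split: if_splits)

lemma sum_char_eq_0:
  assumes \<chi>: "\<chi> \<in> carrier (char_group G)" and h: "h \<in> carrier G" "\<chi> h \<noteq> 1"
  shows "(\<Sum>x\<in>carrier G. \<chi> x) = 0"
proof -
  have "(\<Sum>x\<in>carrier G. \<chi> x) = (\<Sum>x\<in>carrier G. \<chi> (h \<otimes> x))"
    by (rule sum.reindex_bij_witness[of _ "\<lambda>x. h \<otimes> x" "\<lambda>x. inv h \<otimes> x"])
       (use h in \<open>auto simp: m_assoc[symmetric]\<close>)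
  also have "\<dots> = \<chi> h * (\<Sum>x\<in>carrier G. \<chi> x)"
    using h \<chi> by (simp add: char_mult sum_distrib_left)
  finally have "(1 - \<chi> h) * (\<Sum>x\<in>carrier G. \<chi> x) = 0"
    by (simp add: algebra_simps)
  then show ?thesis
    using h by simp
qed

lemma fourier_char:
  assumes \<chi>: "\<chi> \<in> carrier (char_group G)" and \<psi>: "\<psi> \<in> carrier (char_group G)"
  shows "fourier G \<psi> \<chi> = (if \<psi> = \<chi> then of_nat (card (carrier G)) else 0)"
proof (cases "\<psi> = \<chi>")
  case True
  then show ?thesis
    using \<chi> by (simp add: fourier_def char_inv char_nonzero)
next
  case False
  then obtain y where y: "y \<in> carrier G" "\<psi> y \<noteq> \<chi> y"
    using char_eqI \<chi> \<psi> by blast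
  let ?\<theta> = "\<lambda>x\<in>carrier G. \<psi> x * \<chi> (inv x)"
  have "?\<theta> \<in> carrier (char_group G)"
    using \<chi> \<psi> by (auto simp: mem_char_group_iff inv_mult_group)
  moreover have "?\<theta> y \<noteq> 1"
    using y \<chi> by (simp add: char_inv char_nonzero flip: divide_inverse)
  ultimately have "(\<Sum>x\<in>carrier G. ?\<theta> x) = 0"
    using sum_char_eq_0 y(1) by blast
  then show ?thesis
    using False by (simp add: fourier_def)
qed

lemma fourier_translate:
  assumes "\<chi> \<in> carrier (char_group G)" "a \<in> carrier G"
  shows "fourier G (translate f a) \<chi> = \<chi> a * fourier G f \<chi>"
proof -
  have "fourier G (translate f a) \<chi> = (\<Sum>x\<in>carrier G. f (a \<otimes> x) * \<chi> (inv x))"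
    by (simp add: fourier_def translate_apply)
  also have "\<dots> = (\<Sum>y\<in>carrier G. f y * (\<chi> a * \<chi> (inv y)))"
    by (rule sum.reindex_bij_witness[of _ "\<lambda>y. inv a \<otimes> y" "\<lambda>x. a \<otimes> x"])
       (use assms in \<open>auto simp: m_assoc[symmetric] char_mult char_inv char_nonzero\<close>)
  also have "\<dots> = \<chi> a * fourier G f \<chi>"
    by (simp add: fourier_def sum_distrib_left mult_ac)
  finally show ?thesis .
qed

lemma multiplier_eq_char:
  assumes \<chi>: "\<chi> \<in> carrier (char_group G)" "fourier G f \<chi> \<noteq> 0"
    and h: "h \<in> multiplier_group f" and z: "z \<in> carrier G"
  shows "f (h \<otimes> z) = \<chi> h * f z"
proof -
  obtain \<mu> where h_carrier: "h \<in> carrier G" and \<mu>: "\<And>z. z \<in> carrier G \<Longrightarrow> f (h \<otimes> z) = \<mu> * f z"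
    using h by (auto simp: multiplier_group_def)
  then have "translate f h = \<mu> *\<^sub>F extend_by_zero (carrier G) f"
    by (auto simp: fun_eq_iff translate_def)
  then have "\<chi> h * fourier G f \<chi> = \<mu> * fourier G f \<chi>"
    using fourier_translate[OF \<chi>(1) h_carrier, of f] by (auto simp: fourier_scale)
  then show ?thesis
    using \<chi>(2) \<mu> z by simp
qed

lemma independent_characters:
  assumes "of_nat (card (carrier G)) \<noteq> (0 :: 'e::field)"
  shows "fun_space.independent
    (extend_by_zero (carrier G) ` carrier (char_group G :: ('a \<Rightarrow> 'e) monoid))"
    (is "fun_space.independent (?ext ` ?X)")
  unfolding fun_space.dependent_def
proof
  assume "\<exists>v\<in>?ext ` ?X. v \<in> fun_space.span (?ext ` ?X - {v})"
  then obtain \<chi> where \<chi>: "\<chi> \<in> ?X" "?ext \<chi> \<in> fun_space.span (?ext ` ?X - {?ext \<chi>})"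
    by blast
  have "fun_space.subspace {g. fourier G g \<chi> = 0}"
    by (rule fun_space.subspaceI) (simp_all add: fourier_add fourier_scale)
  moreover have "?ext ` ?X - {?ext \<chi>} \<subseteq> {g. fourier G g \<chi> = 0}"
    using \<chi>(1) by (auto simp: fourier_char)
  ultimately have "fun_space.span (?ext ` ?X - {?ext \<chi>}) \<subseteq> {g. fourier G g \<chi> = 0}"
    by (intro fun_space.span_minimal)
  then have "fourier G (?ext \<chi>) \<chi> = 0"
    using \<chi>(2) by blast
  then show False
    using assms \<chi>(1) by (simp add: fourier_char)
qed

lemma finite_characters:
  assumes "finite (carrier G)" "of_nat (card (carrier G)) \<noteq> (0 :: 'e::field)"
  shows "finite (carrier (char_group G :: ('a \<Rightarrow> 'e) monoid))"
proof -
  let ?X = "carrier (char_group G :: ('a \<Rightarrow> 'e) monoid)"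
  have "extend_by_zero (carrier G) ` ?X \<subseteq> fun_space.span ((\<lambda>x. indicator {x}) ` carrier G)"
    using in_span_indicators[OF assms(1) supp_extend_by_zero] by blast
  then have "finite (extend_by_zero (carrier G) ` ?X)"
    using assms(1) fun_space.independent_span_bound[OF _ independent_characters[OF assms(2)]] by blast
  then show ?thesis
    using inj_on_extend_char finite_imageD by blast
qed

end

lemma (in comm_group) char_in_span_translates:
  assumes \<chi>: "\<chi> \<in> carrier (char_group G)" "fourier G f \<chi> \<noteq> 0"
  shows "extend_by_zero (carrier G) \<chi> \<in> fun_space.span (translates f)"
proof -
  have "(\<Sum>a\<in>carrier G. \<chi> (inv a) * f (a \<otimes> x)) = fourier G f \<chi> * \<chi> x"
    if x: "x \<in> carrier G" for x
  proof -
    have "(\<Sum>a\<in>carrier G. \<chi> (inv a) * f (a \<otimes> x)) = fourier G (translate f x) \<chi>"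
      using x by (simp add: fourier_def translate_apply m_comm mult.commute)
    then show ?thesis
      using \<chi>(1) x by (simp add: fourier_translate)
  qed
  then have "extend_by_zero (carrier G) \<chi>
      = inverse (fourier G f \<chi>) *\<^sub>F (\<Sum>a\<in>carrier G. \<chi> (inv a) *\<^sub>F translate f a)"
    using \<chi>(2) by (auto simp: fun_eq_iff translate_def)
  also have "\<dots> \<in> fun_space.span (translates f)"
    by (intro fun_space.span_scale fun_space.span_sum fun_space.span_base) (auto simp: translates_def)
  finally show ?thesis .
qed

section \<open>Modulated indicators of cosets\<close>

lemma (in comm_group) l_coset_eq_r_coset: "\<lbrakk>subgroup H G; a \<in> carrier G\<rbrakk> \<Longrightarrow> a <# H = H #> a"
  using normal.coset_eq[OF subgroup_imp_normal] by simp

lemma (in group) mult_mem_r_coset_iff: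
  assumes H: "subgroup H G" and h: "h \<in> H" and a: "a \<in> carrier G" and x: "x \<in> carrier G"
  shows "h \<otimes> x \<in> H #> a \<longleftrightarrow> x \<in> H #> a"
proof -
  interpret H: subgroup H G
    by fact
  have "x \<otimes> inv a = inv h \<otimes> (h \<otimes> x \<otimes> inv a)"
    using h a x by (simp add: m_assoc[symmetric])
  then have "h \<otimes> x \<otimes> inv a \<in> H \<Longrightarrow> x \<otimes> inv a \<in> H"
    using h by (metis H.m_closed H.m_inv_closed)
  moreover have "x \<otimes> inv a \<in> H \<Longrightarrow> h \<otimes> x \<otimes> inv a \<in> H"
    using h a x by (simp add: m_assoc)
  ultimately show ?thesis
    using h a x by (auto simp: H.rcos_module[OF is_group])
qed

context comm_group
begin

lemma eq_modulated_indicator: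
  assumes \<chi>: "\<chi> \<in> carrier (char_group G)" "fourier G f \<chi> \<noteq> 0"
    and a: "a \<in> carrier G" and supp: "supp_on G f = a <# multiplier_group f"
    and x: "x \<in> carrier G"
  shows "f x = f a * inverse (\<chi> a) * \<chi> x * indicator (a <# multiplier_group f) x"
proof (cases "x \<in> a <# multiplier_group f")
  case True
  then obtain h where h: "h \<in> multiplier_group f" "x = a \<otimes> h"
    by (auto simp: l_coset_def)
  have h_carrier: "h \<in> carrier G"
    using h(1) by (rule subgroup.mem_carrier[OF subgroup_multiplier_group])
  then have "f x = \<chi> h * f a"
    using multiplier_eq_char[OF \<chi> h(1) a] h(2) a by (simp add: m_comm)
  then show ?thesis
    using True h(2) h_carrier a \<chi>(1) by (simp add: char_mult char_nonzero)
next
  case False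
  then show ?thesis
    using supp x by (auto simp: supp_on_def)
qed

lemma supp_on_modulated_indicator:
  assumes f: "\<And>x. x \<in> carrier G \<Longrightarrow> f x = c * \<chi> x * indicator (a <# H) x"
    and c: "c \<noteq> 0" and \<chi>: "\<chi> \<in> carrier (char_group G)" and a: "a \<in> carrier G" and H: "subgroup H G"
  shows "supp_on G f = a <# H"
  using l_coset_carrier[OF _ a H] c \<chi> by (auto simp: supp_on_def f indicator_def char_nonzero)

lemma modulated_indicator_subset_multiplier_group:
  assumes f: "\<And>x. x \<in> carrier G \<Longrightarrow> f x = c * \<chi> x * indicator (a <# H) x"
    and \<chi>: "\<chi> \<in> carrier (char_group G)" and a: "a \<in> carrier G" and H: "subgroup H G"
  shows "H \<subseteq> multiplier_group f"
proof
  fix h assume h: "h \<in> H"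
  have h_carrier: "h \<in> carrier G"
    using h by (rule subgroup.mem_carrier[OF H])
  show "h \<in> multiplier_group f"
  proof (rule multiplier_groupI[of _ "\<chi> h"])
    show "f (h \<otimes> x) = \<chi> h * f x" if "x \<in> carrier G" for x
      using that h h_carrier a \<chi>
      by (simp add: f l_coset_eq_r_coset[OF H a] indicator_def mult_mem_r_coset_iff[OF H] char_mult)
  qed (use h_carrier \<chi> in \<open>simp_all add: char_nonzero\<close>)
qed

end

section \<open>The characters span the functions on the group\<close>

lemma power_primitive_root:
  fixes \<zeta> :: "'e::field"
  assumes "primitive_root_of_unity N \<zeta>"
  shows "(\<zeta> ^ i) ^ N = 1" "\<zeta> ^ i \<noteq> 0"
proof -
  have "0 < N" "\<zeta> ^ N = 1"
    using assms by (auto simp: primitive_root_of_unity_def)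
  then show "(\<zeta> ^ i) ^ N = 1"
    by (metis power_mult mult.commute power_one)
  with \<open>0 < N\<close> show "\<zeta> ^ i \<noteq> 0"
    by (metis power_0_left not_gr_zero zero_neq_one)
qed

lemma sum_powers_primitive_root:
  fixes \<zeta> :: "'e::field"
  assumes \<zeta>: "primitive_root_of_unity N \<zeta>" and j: "j < N"
  shows "(\<Sum>i<N. (\<zeta> ^ i) ^ j) = (if j = 0 then of_nat N else 0)"
proof (cases "j = 0")
  case False
  then have "\<zeta> ^ j \<noteq> 1"
    using \<zeta> j by (simp add: primitive_root_of_unity_def)
  then have "(\<Sum>i<N. (\<zeta> ^ j) ^ i) = 0"
    using one_diff_power_eq[of "\<zeta> ^ j" N] power_primitive_root[OF \<zeta>, of j] by simp
  then show ?thesis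
    using False by (simp add: mult.commute flip: power_mult)
qed simp

context group
begin

definition translation_eigenfunctions :: "'a set \<Rightarrow> ('a \<Rightarrow> 'e::field) set" where
  "translation_eigenfunctions A =
    {g. supp g \<subseteq> carrier G \<and> (\<forall>a\<in>A. \<exists>\<mu>. \<forall>x\<in>carrier G. g (a \<otimes> x) = \<mu> * g x)}"

lemma eigenfunction_eq_scaled_char:
  assumes "g \<in> translation_eigenfunctions (carrier G)"
  shows "\<exists>c. \<exists>\<chi>\<in>carrier (char_group G). g = c *\<^sub>F extend_by_zero (carrier G) \<chi>"
proof -
  have supp: "supp g \<subseteq> carrier G"
    and "\<forall>a\<in>carrier G. \<exists>\<mu>. \<forall>x\<in>carrier G. g (a \<otimes> x) = \<mu> * g x"
    using assms by (auto simp: translation_eigenfunctions_def)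
  then obtain \<mu> where \<mu>: "\<And>a x. \<lbrakk>a \<in> carrier G; x \<in> carrier G\<rbrakk> \<Longrightarrow> g (a \<otimes> x) = \<mu> a * g x"
    using bchoice by metis
  have g_eq: "g a = g \<one> * \<mu> a" if "a \<in> carrier G" for a
    using \<mu>[OF that one_closed] that by simp
  show ?thesis
  proof (cases "g \<one> = 0")
    case True
    have "g x = 0" for x
      using supp g_eq[of x] True by (cases "x \<in> carrier G") auto
    then have "g = 0 *\<^sub>F extend_by_zero (carrier G) \<one>\<^bsub>char_group G\<^esub>"
      by (simp add: fun_eq_iff)
    moreover have "\<one>\<^bsub>char_group G\<^esub> \<in> carrier (char_group G)"
      by (simp add: mem_char_group_iff) (simp add: char_group_def)
    ultimately show ?thesis
      by blast
  next
    case False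
    have \<mu>_mult: "\<mu> (a \<otimes> b) = \<mu> a * \<mu> b" if "a \<in> carrier G" "b \<in> carrier G" for a b
      using \<mu>[OF that] g_eq[of "a \<otimes> b"] g_eq[of b] that False by simp
    have "\<mu> a \<noteq> 0" if "a \<in> carrier G" for a
      using \<mu>_mult[of "inv a" a] g_eq[of \<one>] that False by auto
    then have "restrict \<mu> (carrier G) \<in> carrier (char_group G)"
      using \<mu>_mult by (simp add: mem_char_group_iff)
    moreover have "g x = (g \<one> *\<^sub>F extend_by_zero (carrier G) (restrict \<mu> (carrier G))) x" for x
      using supp g_eq[of x] by (cases "x \<in> carrier G") auto
    ultimately show ?thesis
      by blast
  qed
qed

text \<open>
  For \<open>w\<close> and \<open>a\<close> of exponent \<open>N\<close> this is \<open>N\<close> times the projection onto the eigenspace of translation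
  by \<open>a\<close> with eigenvalue \<open>inverse w\<close>.
\<close>

definition cyclic_average :: "nat \<Rightarrow> 'e::field \<Rightarrow> 'a \<Rightarrow> ('a \<Rightarrow> 'e) \<Rightarrow> 'a \<Rightarrow> 'e" where
  "cyclic_average N w a g = extend_by_zero (carrier G) (\<lambda>x. \<Sum>j<N. w ^ j * g (a [^] j \<otimes> x))"

lemma cyclic_average_mult:
  assumes a: "a \<in> carrier G" "a [^] N = \<one>" and w: "w ^ N = 1" and x: "x \<in> carrier G"
  shows "w * cyclic_average N w a g (a \<otimes> x) = cyclic_average N w a g x"
proof -
  let ?s = "\<lambda>j. w ^ j * g (a [^] j \<otimes> x)"
  have "?s 0 + (\<Sum>j<N. ?s (Suc j)) = (\<Sum>j<N. ?s j) + ?s N"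
    by (rule trans[OF sum.lessThan_Suc_shift[symmetric] sum.lessThan_Suc])
  then have "(\<Sum>j<N. ?s (Suc j)) = (\<Sum>j<N. ?s j)"
    using a w x by simp
  then show ?thesis
    using a x by (simp add: cyclic_average_def sum_distrib_left m_assoc mult.assoc)
qed

lemma sum_cyclic_average:
  assumes "primitive_root_of_unity N \<zeta>" "supp g \<subseteq> carrier G"
  shows "(\<Sum>i<N. cyclic_average N (\<zeta> ^ i) a g) = of_nat N *\<^sub>F g"
proof
  fix x
  show "(\<Sum>i<N. cyclic_average N (\<zeta> ^ i) a g) x = (of_nat N *\<^sub>F g) x"
  proof (cases "x \<in> carrier G")
    case True
    then have "(\<Sum>i<N. cyclic_average N (\<zeta> ^ i) a g) x
        = (\<Sum>j<N. (\<Sum>i<N. (\<zeta> ^ i) ^ j) * g (a [^] j \<otimes> x))"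
      by (simp add: cyclic_average_def sum_distrib_right) (rule sum.swap)
    also have "\<dots> = (\<Sum>j<N. if j = 0 then of_nat N * g x else 0)"
      using True by (intro sum.cong) (auto simp: sum_powers_primitive_root[OF assms(1)])
    also have "\<dots> = of_nat N * g x"
      using assms(1) by (simp add: primitive_root_of_unity_def)
    finally show ?thesis
      by simp
  qed (use assms(2) in \<open>auto simp: cyclic_average_def\<close>)
qed

end

context comm_group
begin

lemma cyclic_average_eigenfunction:
  assumes g: "g \<in> translation_eigenfunctions A" and A: "A \<subseteq> carrier G"
    and a: "a \<in> carrier G" "a [^] N = \<one>" and w: "w ^ N = 1" "w \<noteq> 0"
  shows "cyclic_average N w a g \<in> translation_eigenfunctions (insert a A)"
proof -
  have "cyclic_average N w a g (a \<otimes> x) = inverse w * cyclic_average N w a g x" if "x \<in> carrier G" for x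
    using cyclic_average_mult[OF a w(1) that, of g] w(2) by (simp add: field_simps)
  moreover have "\<exists>\<mu>. \<forall>x\<in>carrier G. cyclic_average N w a g (b \<otimes> x) = \<mu> * cyclic_average N w a g x"
    if b: "b \<in> A" for b
  proof -
    have "\<exists>\<mu>. \<forall>x\<in>carrier G. g (b \<otimes> x) = \<mu> * g x"
      using g b by (simp add: translation_eigenfunctions_def)
    then obtain \<mu> where \<mu>: "\<forall>x\<in>carrier G. g (b \<otimes> x) = \<mu> * g x" ..
    have "g (a [^] j \<otimes> (b \<otimes> x)) = \<mu> * g (a [^] j \<otimes> x)" if "x \<in> carrier G" for x and j :: nat
      using \<mu> that a b A by (simp add: m_lcomm[of _ b] subset_iff)
    then have "\<forall>x\<in>carrier G. cyclic_average N w a g (b \<otimes> x) = \<mu> * cyclic_average N w a g x"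
      using b A by (auto simp: cyclic_average_def sum_distrib_left mult.left_commute)
    then show ?thesis ..
  qed
  moreover have "supp (cyclic_average N w a g) \<subseteq> carrier G"
    unfolding cyclic_average_def by (rule supp_extend_by_zero)
  ultimately show ?thesis
    by (auto simp: translation_eigenfunctions_def)
qed

lemma eigenfunctions_subset_span_insert:
  fixes \<zeta> :: "'e::field"
  assumes \<zeta>: "primitive_root_of_unity N \<zeta>" "of_nat N \<noteq> (0 :: 'e)"
    and A: "A \<subseteq> carrier G" and a: "a \<in> carrier G" "a [^] N = \<one>"
  shows "(translation_eigenfunctions A :: ('a \<Rightarrow> 'e) set)
    \<subseteq> fun_space.span (translation_eigenfunctions (insert a A))"
proof
  fix g :: "'a \<Rightarrow> 'e"
  assume g: "g \<in> translation_eigenfunctions A"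
  have "cyclic_average N (\<zeta> ^ i) a g \<in> translation_eigenfunctions (insert a A)" for i
    using g A a power_primitive_root[OF \<zeta>(1)] by (rule cyclic_average_eigenfunction)
  then have "(\<Sum>i<N. cyclic_average N (\<zeta> ^ i) a g)
      \<in> fun_space.span (translation_eigenfunctions (insert a A))"
    by (intro fun_space.span_sum fun_space.span_base)
  then have "inverse (of_nat N) *\<^sub>F (\<Sum>i<N. cyclic_average N (\<zeta> ^ i) a g)
      \<in> fun_space.span (translation_eigenfunctions (insert a A))"
    by (rule fun_space.span_scale)
  moreover have "(\<Sum>i<N. cyclic_average N (\<zeta> ^ i) a g) = of_nat N *\<^sub>F g"
    using \<zeta>(1) g by (intro sum_cyclic_average) (auto simp: translation_eigenfunctions_def)
  ultimately show "g \<in> fun_space.span (translation_eigenfunctions (insert a A))"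
    using \<zeta>(2) by simp
qed

lemma in_span_eigenfunctions:
  fixes f :: "'a \<Rightarrow> 'e::field" and \<zeta> :: 'e
  assumes \<zeta>: "primitive_root_of_unity N \<zeta>" "of_nat N \<noteq> (0 :: 'e)"
    and A: "finite A" "A \<subseteq> carrier G" "\<And>a. a \<in> A \<Longrightarrow> a [^] N = \<one>"
    and f: "supp f \<subseteq> carrier G"
  shows "f \<in> fun_space.span (translation_eigenfunctions A)"
  using A
proof (induction A rule: finite_induct)
  case empty
  then show ?case
    using f by (intro fun_space.span_base) (simp add: translation_eigenfunctions_def)
next
  case (insert a A)
  then have "(translation_eigenfunctions A :: ('a \<Rightarrow> 'e) set)
      \<subseteq> fun_space.span (translation_eigenfunctions (insert a A))"
    by (intro eigenfunctions_subset_span_insert[OF \<zeta>]) auto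
  then have "fun_space.span (translation_eigenfunctions A :: ('a \<Rightarrow> 'e) set)
      \<subseteq> fun_space.span (translation_eigenfunctions (insert a A))"
    by (rule fun_space.span_minimal[OF _ fun_space.subspace_span])
  moreover have "f \<in> fun_space.span (translation_eigenfunctions A)"
    using insert.prems by (intro insert.IH) auto
  ultimately show ?case ..
qed

end

section \<open>Fourier inversion\<close>

lemma (in group)
  assumes "finite (carrier G)"
  shows pow_group_exponent: "x \<in> carrier G \<Longrightarrow> x [^] group_exponent G = \<one>"
    and group_exponent_dvd_card: "group_exponent G dvd card (carrier G)"
proof -
  let ?P = "\<lambda>n::nat. 0 < n \<and> (\<forall>x\<in>carrier G. x [^] n = \<one>)"
  have "?P (card (carrier G))"
    using assms pow_order_eq_1 order_gt_0_iff_finite by (simp add: Coset.order_def)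
  then have exponent: "?P (group_exponent G)"
    unfolding group_exponent_def by (rule LeastI)
  then show "x \<in> carrier G \<Longrightarrow> x [^] group_exponent G = \<one>"
    by blast
  let ?q = "card (carrier G) div group_exponent G" and ?r = "card (carrier G) mod group_exponent G"
  have "x [^] ?r = \<one>" if x: "x \<in> carrier G" for x
  proof -
    have "x [^] ?r = (x [^] group_exponent G) [^] ?q \<otimes> x [^] ?r"
      using x exponent by simp
    also have "\<dots> = x [^] (group_exponent G * ?q + ?r)"
      using x by (simp only: nat_pow_pow nat_pow_mult)
    also have "\<dots> = \<one>"
      using x pow_order_eq_1 by (simp add: Coset.order_def)
    finally show ?thesis .
  qed
  moreover have "?r < group_exponent G"
    using exponent by simp
  then have "\<not> ?P ?r"
    unfolding group_exponent_def[of G] by (rule not_less_Least)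
  ultimately show "group_exponent G dvd card (carrier G)"
    by (simp add: dvd_eq_mod_eq_0)
qed

locale split_comm_group = comm_group G for G :: "('g, 'm) monoid_scheme" (structure) +
  fixes \<zeta> :: "'e::field"
  assumes finite_carrier: "finite (carrier G)"
    and of_nat_card_nonzero: "of_nat (card (carrier G)) \<noteq> (0 :: 'e)"
    and primitive: "primitive_root_of_unity (group_exponent G) \<zeta>"
begin

abbreviation Ghat :: "('g \<Rightarrow> 'e) monoid" where "Ghat \<equiv> char_group G"

lemmas finite_Ghat = finite_characters[OF finite_carrier of_nat_card_nonzero]

lemma in_span_characters:
  fixes f :: "'g \<Rightarrow> 'e"
  assumes "supp f \<subseteq> carrier G"
  shows "f \<in> fun_space.span (extend_by_zero (carrier G) ` carrier Ghat)"
proof -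
  have "of_nat (group_exponent G) \<noteq> (0 :: 'e)"
    using of_nat_card_nonzero group_exponent_dvd_card[OF finite_carrier] by (auto elim!: dvdE)
  then have "f \<in> fun_space.span (translation_eigenfunctions (carrier G))"
    using finite_carrier order_refl pow_group_exponent[OF finite_carrier] assms
    by (rule in_span_eigenfunctions[OF primitive])
  moreover have "(translation_eigenfunctions (carrier G) :: ('g \<Rightarrow> 'e) set)
      \<subseteq> fun_space.span (extend_by_zero (carrier G) ` carrier Ghat)"
  proof
    fix g :: "'g \<Rightarrow> 'e"
    assume "g \<in> translation_eigenfunctions (carrier G)"
    then obtain c \<chi> where "\<chi> \<in> carrier Ghat" "g = c *\<^sub>F extend_by_zero (carrier G) \<chi>"
      using eigenfunction_eq_scaled_char by blast
    then show "g \<in> fun_space.span (extend_by_zero (carrier G) ` carrier Ghat)"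
      by (simp add: fun_space.span_scale fun_space.span_base)
  qed
  then have "fun_space.span (translation_eigenfunctions (carrier G) :: ('g \<Rightarrow> 'e) set)
      \<subseteq> fun_space.span (extend_by_zero (carrier G) ` carrier Ghat)"
    by (rule fun_space.span_minimal[OF _ fun_space.subspace_span])
  ultimately show ?thesis ..
qed

theorem fourier_inversion:
  fixes f :: "'g \<Rightarrow> 'e"
  assumes x: "x \<in> carrier G"
  shows "(\<Sum>\<chi>\<in>carrier Ghat. fourier G f \<chi> * \<chi> x) = of_nat (card (carrier G)) * f x"
proof -
  let ?inverts = "{g. (\<Sum>\<chi>\<in>carrier Ghat. fourier G g \<chi> * \<chi> x) = of_nat (card (carrier G)) * g x}"
  have "fun_space.subspace ?inverts"
  proof (rule fun_space.subspaceI)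
    fix g h assume "g \<in> ?inverts" "h \<in> ?inverts"
    then show "g + h \<in> ?inverts"
      by (simp add: fourier_add distrib_right distrib_left sum.distrib)
  next
    fix c g assume "g \<in> ?inverts"
    then show "c *\<^sub>F g \<in> ?inverts"
      by (simp add: fourier_scale mult.assoc mult.left_commute[of _ c] flip: sum_distrib_left)
  qed simp
  moreover have "extend_by_zero (carrier G) \<psi> \<in> ?inverts" if \<psi>: "\<psi> \<in> carrier Ghat" for \<psi>
  proof -
    have "(\<Sum>\<chi>\<in>carrier Ghat. fourier G \<psi> \<chi> * \<chi> x)
        = (\<Sum>\<chi>\<in>carrier Ghat. if \<chi> = \<psi> then of_nat (card (carrier G)) * \<psi> x else 0)"
      using \<psi> by (intro sum.cong) (auto simp: fourier_char)
    then show ?thesis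
      using \<psi> x finite_Ghat by simp
  qed
  ultimately have "fun_space.span (extend_by_zero (carrier G) ` carrier Ghat) \<subseteq> ?inverts"
    by (intro fun_space.span_minimal) auto
  then have "extend_by_zero (carrier G) f \<in> ?inverts"
    using in_span_characters[OF supp_extend_by_zero] by (rule subsetD)
  then show ?thesis
    using x by simp
qed

lemma eq_sum_supp_fourier:
  assumes x: "x \<in> carrier G"
  shows "f x = (\<Sum>\<chi>\<in>supp_on Ghat (fourier G f). fourier G f \<chi> / of_nat (card (carrier G)) * \<chi> x)"
proof -
  have "f x = (\<Sum>\<chi>\<in>carrier Ghat. fourier G f \<chi> * \<chi> x) / of_nat (card (carrier G))"
    using fourier_inversion[OF x, of f] of_nat_card_nonzero by simp
  also have "(\<Sum>\<chi>\<in>carrier Ghat. fourier G f \<chi> * \<chi> x)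
      = (\<Sum>\<chi>\<in>supp_on Ghat (fourier G f). fourier G f \<chi> * \<chi> x)"
    using finite_Ghat by (intro sum.mono_neutral_right) (auto simp: supp_on_def)
  finally show ?thesis
    by (simp add: sum_divide_distrib)
qed

theorem dim_translates_eq_card_supp_fourier:
  "fun_space.dim (translates f) = card (supp_on Ghat (fourier G f))"
proof (rule antisym)
  let ?S = "supp_on Ghat (fourier G f)"
  have S: "?S \<subseteq> carrier Ghat"
    by (auto simp: supp_on_def)
  show "fun_space.dim (translates f) \<le> card ?S"
  proof (rule dim_translates_le_of_multiplicative_sum)
    show "finite ?S"
      using S finite_Ghat by (rule finite_subset)
    show "\<chi> (x \<otimes> y) = \<chi> x * \<chi> y" if "\<chi> \<in> ?S" "x \<in> carrier G" "y \<in> carrier G" for \<chi> x y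
      using that S by (intro char_mult) auto
  qed (rule eq_sum_supp_fourier)
  have "card (extend_by_zero (carrier G) ` ?S) \<le> fun_space.dim (translates f)"
  proof (rule fun_space.card_independent_le_dim)
    show "fun_space.independent (extend_by_zero (carrier G) ` ?S)"
      using independent_characters[OF of_nat_card_nonzero] image_mono[OF S]
      by (rule fun_space.independent_mono)
    show "extend_by_zero (carrier G) ` ?S \<subseteq> fun_space.span (translates f)"
      by (rule image_subsetI, rule char_in_span_translates) (simp_all add: supp_on_def)
  qed (rule finite_translates[OF finite_carrier])
  then show "card ?S \<le> fun_space.dim (translates f)"
    using card_image[OF inj_on_subset[OF inj_on_extend_char S]] by simp
qed

end

section \<open>The uncertainty principle\<close>

lemma supp_on_subgroup: "subgroup K M \<Longrightarrow> supp_on (M\<lparr>carrier := K\<rparr>) F = supp_on M F \<inter> K"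
  using subgroup.subset by (auto simp: supp_on_def)

lemma (in comm_group) comm_group_subgroup: "subgroup K G \<Longrightarrow> comm_group (G\<lparr>carrier := K\<rparr>)"
  using subgroup.subset[of K G] subgroup_imp_group[of K]
  by (intro group.group_comm_groupI) (auto simp: m_comm subset_iff)

lemma (in group) dim_translates_fourier_le:
  fixes f :: "'a \<Rightarrow> 'e::field"
  assumes finite_carrier: "finite (carrier G)" and K: "subgroup K (char_group G)"
  shows "fun_space.dim (group.translates (char_group G\<lparr>carrier := K\<rparr>) (fourier G f))
    \<le> card (supp_on G f)"
proof -
  interpret K: comm_group "char_group G\<lparr>carrier := K\<rparr>"
    using comm_group_char_group[OF is_group] K by (rule comm_group.comm_group_subgroup)
  show ?thesis
  proof (rule K.dim_translates_le_of_multiplicative_sum)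
    show "finite (supp_on G f)"
      using finite_carrier by (simp add: supp_on_def)
    show "(\<chi> \<otimes>\<^bsub>char_group G\<lparr>carrier := K\<rparr>\<^esub> \<psi>) (inv x) = \<chi> (inv x) * \<psi> (inv x)"
      if "x \<in> supp_on G f" for x and \<chi> \<psi> :: "'a \<Rightarrow> 'e"
      using that by (simp add: supp_on_def char_group_def)
  qed (rule fourier_eq_sum_supp_on[OF finite_carrier])
qed

context split_comm_group
begin

sublocale Ghat: comm_group Ghat
  by (rule comm_group_char_group) (rule is_group)

theorem uncertainty_principle_subgroup:
  assumes K: "subgroup K Ghat" and nonzero: "\<exists>\<chi>\<in>K. fourier G f \<chi> \<noteq> 0"
  shows "card K \<le> card (supp_on G f) * card (supp_on Ghat (fourier G f) \<inter> K)"
proof -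
  interpret K: comm_group "Ghat\<lparr>carrier := K\<rparr>"
    using K by (rule Ghat.comm_group_subgroup)
  have "finite K"
    using subgroup.subset[OF K] finite_Ghat by (rule finite_subset)
  then have "card K
      \<le> fun_space.dim (K.translates (fourier G f)) * card (supp_on Ghat (fourier G f) \<inter> K)"
    using K.card_carrier_le_dim_translates[of "fourier G f"] nonzero
    unfolding supp_on_subgroup[OF K, symmetric] by (auto simp: supp_on_def)
  also have "\<dots> \<le> card (supp_on G f) * card (supp_on Ghat (fourier G f) \<inter> K)"
    using dim_translates_fourier_le[OF finite_carrier K] by (rule mult_le_mono1)
  finally show ?thesis .
qed

theorem uncertainty_eq_on_subgroup_imp_coset:
  assumes K: "subgroup K Ghat" and nonzero: "\<exists>\<chi>\<in>K. fourier G f \<chi> \<noteq> 0"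
    and card_eq: "card (supp_on G f) * card (supp_on Ghat (fourier G f) \<inter> K) = card K"
  shows "\<exists>L \<chi>. subgroup L (Ghat\<lparr>carrier := K\<rparr>) \<and> \<chi> \<in> K \<and>
    supp_on Ghat (fourier G f) \<inter> K = \<chi> <#\<^bsub>Ghat\<^esub> L"
proof -
  interpret K: comm_group "Ghat\<lparr>carrier := K\<rparr>"
    using K by (rule Ghat.comm_group_subgroup)
  let ?L = "K.multiplier_group (fourier G f)"
  have L: "subgroup ?L (Ghat\<lparr>carrier := K\<rparr>)"
    by (rule K.subgroup_multiplier_group)
  obtain \<chi> where \<chi>: "\<chi> \<in> K" "fourier G f \<chi> \<noteq> 0"
    using nonzero by blast
  have "supp_on (Ghat\<lparr>carrier := K\<rparr>) (fourier G f) = ?L #>\<^bsub>Ghat\<lparr>carrier := K\<rparr>\<^esub> \<chi>"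
  proof (rule K.supp_on_eq_coset_multiplier_group)
    show "finite (carrier (Ghat\<lparr>carrier := K\<rparr>))"
      using subgroup.subset[OF K] finite_Ghat by (simp add: finite_subset)
    show "fun_space.dim (K.translates (fourier G f)) * card (supp_on (Ghat\<lparr>carrier := K\<rparr>) (fourier G f))
        \<le> card (carrier (Ghat\<lparr>carrier := K\<rparr>))"
      using mult_le_mono1[OF dim_translates_fourier_le[OF finite_carrier K, of f],
          of "card (supp_on Ghat (fourier G f) \<inter> K)"] card_eq
      by (simp add: supp_on_subgroup[OF K])
  qed (use \<chi> in \<open>simp add: supp_on_def\<close>)
  also have "\<dots> = \<chi> <#\<^bsub>Ghat\<lparr>carrier := K\<rparr>\<^esub> ?L"
    using K.l_coset_eq_r_coset[OF L] \<chi>(1) by simp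
  finally have "supp_on Ghat (fourier G f) \<inter> K = \<chi> <#\<^bsub>Ghat\<^esub> ?L"
    by (simp add: supp_on_subgroup[OF K] l_coset_def)
  then show ?thesis
    using L \<chi>(1) by blast
qed

theorem uncertainty_principle:
  assumes "supp_on G f \<noteq> {}"
  shows "card (carrier G) \<le> card (supp_on G f) * card (supp_on Ghat (fourier G f))"
  using card_carrier_le_dim_translates[OF finite_carrier assms]
  by (simp add: dim_translates_eq_card_supp_fourier mult.commute)

lemma uncertainty_eq_if_modulated_indicator:
  assumes f: "\<And>x. x \<in> carrier G \<Longrightarrow> f x = c * \<chi> x * indicator (a <# H) x"
    and c: "c \<noteq> 0" and \<chi>: "\<chi> \<in> carrier Ghat" and a: "a \<in> carrier G" and H: "subgroup H G"
  shows "card (supp_on G f) * card (supp_on Ghat (fourier G f)) = card (carrier G)"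
proof (rule antisym)
  have supp: "supp_on G f = H #> a"
    using supp_on_modulated_indicator[OF f c \<chi> a H] by (simp only: l_coset_eq_r_coset[OF H a])
  have card_supp: "card (supp_on G f) = card H"
    unfolding supp using subgroup.subset[OF H] a card_rcosets_equal[OF rcosetsI] by simp
  have "fun_space.dim (translates f) * card H \<le> card (carrier G)"
    using finite_carrier H modulated_indicator_subset_multiplier_group[OF f \<chi> a H]
    by (rule dim_translates_mult_card_le)
  then show "card (supp_on G f) * card (supp_on Ghat (fourier G f)) \<le> card (carrier G)"
    by (simp add: card_supp dim_translates_eq_card_supp_fourier mult.commute)
  have "supp_on G f \<noteq> {}"
    unfolding supp using rcos_self[OF a H] by blast
  then show "card (carrier G) \<le> card (supp_on G f) * card (supp_on Ghat (fourier G f))"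
    by (rule uncertainty_principle)
qed

theorem uncertainty_eq_iff_modulated_indicator:
  assumes "supp_on G f \<noteq> {}"
  shows "card (supp_on G f) * card (supp_on Ghat (fourier G f)) = card (carrier G) \<longleftrightarrow>
    (\<exists>c \<chi> a H. c \<noteq> 0 \<and> \<chi> \<in> carrier Ghat \<and> a \<in> carrier G \<and> subgroup H G \<and>
      (\<forall>x\<in>carrier G. f x = c * \<chi> x * indicator (a <# H) x))"
    (is "?eq \<longleftrightarrow> ?modulated")
proof
  assume card_eq: ?eq
  have "card (carrier G) \<noteq> 0"
    using finite_carrier by auto
  then have "supp_on Ghat (fourier G f) \<noteq> {}"
    using card_eq by auto
  then obtain \<chi> where \<chi>: "\<chi> \<in> carrier Ghat" "fourier G f \<chi> \<noteq> 0"
    by (auto simp: supp_on_def)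
  obtain a where a: "a \<in> carrier G" "f a \<noteq> 0"
    using assms by (auto simp: supp_on_def)
  have H: "subgroup (multiplier_group f) G"
    by (rule subgroup_multiplier_group)
  have "supp_on G f = multiplier_group f #> a"
  proof (rule supp_on_eq_coset_multiplier_group[OF finite_carrier])
    show "fun_space.dim (translates f) * card (supp_on G f) \<le> card (carrier G)"
      using card_eq by (simp add: dim_translates_eq_card_supp_fourier mult.commute)
  qed (use a in \<open>simp add: supp_on_def\<close>)
  then have "supp_on G f = a <# multiplier_group f"
    using l_coset_eq_r_coset[OF H a(1)] by simp
  then have "\<forall>x\<in>carrier G. f x = f a * inverse (\<chi> a) * \<chi> x * indicator (a <# multiplier_group f) x"
    using eq_modulated_indicator[OF \<chi> a(1)] by blast
  moreover have "f a * inverse (\<chi> a) \<noteq> 0"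
    using a \<chi>(1) by (simp add: char_nonzero)
  ultimately show ?modulated
    using \<chi>(1) a(1) H by blast
next
  assume ?modulated
  then obtain c \<chi> a H where c: "c \<noteq> 0" and \<chi>: "\<chi> \<in> carrier Ghat" and a: "a \<in> carrier G"
    and H: "subgroup H G" and f: "\<And>x. x \<in> carrier G \<Longrightarrow> f x = c * \<chi> x * indicator (a <# H) x"
    by blast
  show ?eq
    by (rule uncertainty_eq_if_modulated_indicator[OF f c \<chi> a H])
qed

end

lemma
  fixes \<iota> :: "'f::field \<Rightarrow> 'e::field"
  assumes \<iota>: "\<iota> \<in> ring_hom ring_of_type_algebra ring_of_type_algebra"
  shows ring_hom_field_eq_0_iff: "\<iota> x = 0 \<longleftrightarrow> x = 0"
    and ring_hom_field_of_nat: "\<iota> (of_nat n) = of_nat n"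
proof -
  have add: "\<iota> (x + y) = \<iota> x + \<iota> y" and mult: "\<iota> (x * y) = \<iota> x * \<iota> y" and one: "\<iota> 1 = 1" for x y
    using \<iota> by (auto simp: ring_hom_def ring_of_type_algebra_def)
  have zero: "\<iota> 0 = 0"
    using add[of 0 0] by (metis add_0 add_cancel_right_right)
  show "\<iota> (of_nat n) = of_nat n"
    by (induction n) (simp_all add: zero add one)
  show "\<iota> x = 0 \<longleftrightarrow> x = 0"
  proof (cases "x = 0")
    case False
    then have "\<iota> x * \<iota> (inverse x) = 1"
      using mult[of x "inverse x"] one by simp
    then show ?thesis
      using False by auto
  qed (simp add: zero)
qed

theorem mainTheorem10:
  fixes G :: "('g, 'm) monoid_scheme"
    and \<iota> :: "'f::field \<Rightarrow> 'e::field"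
  assumes "comm_group G" and "finite (carrier G)"
    and "CHAR('f) = 0 \<or> \<not> CHAR('f) dvd card (carrier G)"
    and "\<iota> \<in> ring_hom ring_of_type_algebra ring_of_type_algebra"
    and "\<exists>\<zeta>::'e. primitive_root_of_unity (group_exponent G) \<zeta>"
  shows
    "(\<forall>(K :: ('g \<Rightarrow> 'e) set) (f :: 'g \<Rightarrow> 'f).
        subgroup K (char_group G) \<longrightarrow> (\<exists>\<chi>\<in>K. fourier G (\<iota> \<circ> f) \<chi> \<noteq> 0) \<longrightarrow>
        card (supp_on G f) * card (supp_on (char_group G) (fourier G (\<iota> \<circ> f)) \<inter> K) \<ge> card K \<and>
        (card (supp_on G f) * card (supp_on (char_group G) (fourier G (\<iota> \<circ> f)) \<inter> K) = card K \<longrightarrow>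
          (\<exists>L \<chi>. subgroup L ((char_group G)\<lparr>carrier := K\<rparr>) \<and> \<chi> \<in> K \<and>
             supp_on (char_group G) (fourier G (\<iota> \<circ> f)) \<inter> K = \<chi> <#\<^bsub>char_group G\<^esub> L))) \<and>
     (\<forall>f :: 'g \<Rightarrow> 'f. (\<exists>x\<in>carrier G. f x \<noteq> 0) \<longrightarrow>
        card (supp_on G f) * card (supp_on (char_group G) (fourier G (\<iota> \<circ> f))) \<ge> card (carrier G) \<and>
        (card (supp_on G f) * card (supp_on (char_group G) (fourier G (\<iota> \<circ> f))) = card (carrier G) \<longleftrightarrow>
          (\<exists>c \<chi> a H. c \<noteq> 0 \<and> \<chi> \<in> carrier (char_group G) \<and> a \<in> carrier G \<and> subgroup H G \<and>
             (\<forall>x\<in>carrier G. \<iota> (f x) = c * \<chi> x * indicator (a <#\<^bsub>G\<^esub> H) x))))"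
proof -
  interpret comm_group G by fact
  obtain \<zeta> :: 'e where \<zeta>: "primitive_root_of_unity (group_exponent G) \<zeta>"
    using assms(5) by blast
  note \<iota> = ring_hom_field_eq_0_iff[OF assms(4)] ring_hom_field_of_nat[OF assms(4)]
  have "card (carrier G) \<noteq> 0"
    using assms(2) by auto
  then have "of_nat (card (carrier G)) \<noteq> (0 :: 'f)"
    using assms(3) by (auto simp: of_nat_eq_0_iff_char_dvd)
  then have "of_nat (card (carrier G)) \<noteq> (0 :: 'e)"
    by (simp flip: \<iota>)
  then interpret split_comm_group G \<zeta>
    using assms(2) \<zeta> by unfold_locales
  have supp: "supp_on G f = supp_on G (\<iota> \<circ> f)" for f
    by (simp add: supp_on_def \<iota>)
  have supp_nonempty: "supp_on G (\<iota> \<circ> f) \<noteq> {} \<longleftrightarrow> (\<exists>x\<in>carrier G. f x \<noteq> 0)" for f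
    by (auto simp: supp_on_def \<iota>)
  show ?thesis
    unfolding supp supp_nonempty[symmetric]
    by (intro conjI allI impI uncertainty_principle_subgroup uncertainty_eq_on_subgroup_imp_coset
        uncertainty_principle) (simp_all add: uncertainty_eq_iff_modulated_indicator)
qed

end
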